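(* Let $0<\vartheta\le1$, $m\in\mathbb{N}$ and $\boldsymbol{x}_0\in\Omega$, and consider $f\in\mathcal{C}^{m,\vartheta}\big(B_R(\boldsymbol{x}_0)\big)$. Assume that the samplets satisfy the vanishing moment condition $(\sigma_{j,k},p)_\Omega=0$ for all $p\in\mathcal{P}_q(\Omega)$ with some $q\ge m$. Then, for every cluster $\tau$ that contains $\boldsymbol{x}_0$ (and the samplets $\sigma_{j,k}$ supported on $\tau$), there holds $$|(\sigma_{j,k},f)_\Omega|\lesssim\operatorname{diam}(\tau)^{\vartheta+m}\sqrt{\#\tau}.$$ In particular, in the framework of balanced $2^d$-trees, where $\Omega=[0,1]^d$, $$|(\sigma_{j,k},f)_\Omega|\lesssim\sqrt{N d^{\vartheta+m}}\;2^{-j(\vartheta+m+d/2)},$$ where $N$ is the number of data sites.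
   Context: Notation. $\Omega\subset\mathbb{R}^d$ is a region, $f$ is a real-valued function on $\Omega$, $R>0$ and $B_R(\boldsymbol{x}_0)=\{\boldsymbol{x}\in\mathbb{R}^d:\|\boldsymbol{x}-\boldsymbol{x}_0\|_2\le R\}$. $A\lesssim B$ means that $A$ is bounded by a uniform constant times $B$, where the constant does not depend on any parameters which $A$ and $B$ might depend on; $A\sim B$ means $A\lesssim B$ and $B\lesssim A$. Hölder spaces. For a closed set $K\subseteq\mathbb{R}^d$, $k\in\mathbb{N}$ (with $0\in\mathbb{N}$) and $0<\vartheta\le1$, $f\in\mathcal{C}^{k,\vartheta}(K)$ means that $f$ is $k$ times differentiable in $K$ and $|\partial^{\boldsymbol{\beta}}f(\boldsymbol{x})-\partial^{\boldsymbol{\beta}}f(\boldsymbol{y})|\lesssim\|\boldsymbol{x}-\boldsymbol{y}\|_2^\vartheta$ for every multi-index $|\boldsymbol{\beta}|=k$ and all $\boldsymbol{x},\boldsymbol{y}\in K$. Cluster trees. Let $X=\{\boldsymbol{x}_1,\dots,\boldsymbol{x}_N\}\subset\Omega$ be a set of $N$ data sites, assumed quasi-uniform (fill distance similar to separation radius). A cluster tree $\mathcal{T}$ for $X$ is a tree whose nodes (clusters) are subsets of $X$, whose root is $X$, and in which every non-leaf node is the disjoint union of its children. The level $j_\tau$ of $\tau$ is the number of edges from the root to $\tau$; the depth $J$ is the maximal level. $\#\tau$ is the cardinality of $\tau$ and $\operatorname{diam}(\tau)=\max_{\boldsymbol{x}_i,\boldsymbol{x}_j\in\tau}\|\boldsymbol{x}_i-\boldsymbol{x}_j\|_2$.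 A $2^d$-tree is a cluster tree of depth $J$ in which every cluster $\tau$ with $j_\tau<J$ has exactly $2^d$ children. It is balanced if $\#\tau\sim N2^{-j_\tau d}$. The $2^d$-tree is obtained by geometric clustering, i.e. recursive dyadic subdivision of the edges of the bounding box; for $\Omega=[0,1]^d$, a cluster on level $j$ is then contained in a dyadic cube of side length $2^{-j}$ (diameter $\sqrt d\,2^{-j}$). Samplets. For a functional $\sigma=\sum_{i=1}^N\omega_i\delta_{\boldsymbol{x}_i}$ put $(\sigma,f)_\Omega=\sum_{i=1}^N\omega_i f(\boldsymbol{x}_i)$. The span $\mathcal{X}'$ of $\delta_{\boldsymbol{x}_1},\dots,\delta_{\boldsymbol{x}_N}$ carries the inner product $\langle\sum u_i\delta_{\boldsymbol{x}_i},\sum v_i\delta_{\boldsymbol{x}_i}\rangle=\sum u_iv_i$. $\mathcal{P}_q(\Omega)$ denotes the polynomials of total degree at most $q$. Samplets are built recursively from the leaves to the root of $\mathcal{T}$: for a cluster $\tau$ on level $j$, one collects the scaling distributions $\boldsymbol{\Phi}^\tau_{j+1}$ of its children (for a leaf: the $\delta_{\boldsymbol{x}_i}$, $\boldsymbol{x}_i\in\tau$), takes the orthogonal factor $\boldsymbol{Q}^\tau_j=[\boldsymbol{Q}^\tau_{j,\Phi},\boldsymbol{Q}^\tau_{j,\Sigma}]$ of a QR decomposition of the transpose of the moment matrix $[(\boldsymbol{x}^{\boldsymbol{\beta}},\boldsymbol{\Phi}^\tau_{j+1})_\Omega]_{|\boldsymbol{\beta}|\le q}$, and sets $[\boldsymbol{\Phi}^\tau_j,\boldsymbol{\Sigma}^\tau_j]=\boldsymbol{\Phi}^\tau_{j+1}\boldsymbol{Q}^\tau_j$;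 the elements of $\boldsymbol{\Sigma}^\tau_j$ are the samplets $\sigma_{j,k}$ of $\tau$ (with $j$ the level and $k$ an index within the level), those of $\boldsymbol{\Phi}_j^\tau$ its scaling distributions. A samplet $\sigma_{j,k}$ supported on $\tau$ has the form $\sigma_{j,k}=\sum_{\boldsymbol{x}_\ell\in\tau}\omega^{(\ell)}_{j,k}\delta_{\boldsymbol{x}_\ell}$ with $\sum_\ell|\omega^{(\ell)}_{j,k}|^2=1$, and the samplets are orthonormal in $\mathcal{X}'$.
   Formalization: The constant may depend on f and, for clusters reaching outside B_R(x_0), on a bound M of |f| at their sites outside that ball; without such a bound the estimate, uniform in the data sites, fails for f unbounded on Ω. *)

theory Defs
  imports "HOL-Analysis.Analysis"
begin

section \<open>Polynomials and Hoelder spaces\<close>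

text \<open>Multi-indices are functions \<open>'n \<Rightarrow> nat\<close>, where \<open>'n\<close> indexes the coordinates of
  \<open>real ^ 'n\<close>; the dimension \<open>d\<close> is \<open>CARD('n)\<close>.\<close>

definition mi_abs :: "('n::finite \<Rightarrow> nat) \<Rightarrow> nat" where
  "mi_abs \<beta> = (\<Sum>i\<in>UNIV. \<beta> i)"

definition monomial :: "('n::finite \<Rightarrow> nat) \<Rightarrow> real ^ 'n \<Rightarrow> real" where
  "monomial \<beta> x = (\<Prod>i\<in>UNIV. (x $ i) ^ \<beta> i)"

definition polys :: "nat \<Rightarrow> (real ^ 'n::finite \<Rightarrow> real) set" where
  "polys q = {p. \<exists>c. p = (\<lambda>x. \<Sum>\<beta> | mi_abs \<beta> \<le> q. c \<beta> * monomial \<beta> x)}"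

text \<open>\<open>f\<close> is \<open>k\<close> times differentiable in \<open>K\<close>, and \<open>D \<beta>\<close> is its partial derivative
  of index \<open>\<beta>\<close> for all \<open>|\<beta>| \<le> k\<close>: the gradient of \<open>D \<beta>\<close> consists of the functions
  \<open>D (\<beta> + e\<^sub>i)\<close>. Derivatives are taken relative to \<open>K\<close>, hence one-sided at boundary points;
  on a ball of positive radius they are unique.\<close>

definition partial_derivatives ::
    "nat \<Rightarrow> (real ^ 'n::finite) set \<Rightarrow> (real ^ 'n \<Rightarrow> real) \<Rightarrow> (('n \<Rightarrow> nat) \<Rightarrow> real ^ 'n \<Rightarrow> real) \<Rightarrow> bool"
  where
  "partial_derivatives k K f D \<longleftrightarrow>
     (\<forall>x\<in>K. D (\<lambda>_. 0) x = f x) \<and>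
     (\<forall>\<beta>. mi_abs \<beta> < k \<longrightarrow> (\<forall>x\<in>K.
        (D \<beta> has_derivative (\<lambda>h. \<Sum>i\<in>UNIV. D (\<beta>(i := Suc (\<beta> i))) x * h $ i)) (at x within K)))"

definition holder_space :: "nat \<Rightarrow> real \<Rightarrow> (real ^ 'n::finite) set \<Rightarrow> (real ^ 'n \<Rightarrow> real) set" where
  "holder_space k \<theta> K = {f. \<exists>D. partial_derivatives k K f D \<and>
     (\<exists>L. \<forall>\<beta>. mi_abs \<beta> = k \<longrightarrow>
        (\<forall>x\<in>K. \<forall>y\<in>K. \<bar>D \<beta> x - D \<beta> y\<bar> \<le> L * norm (x - y) powr \<theta>))}"


section \<open>Data sites and cluster trees\<close>

definition fill_distance :: "'a::metric_space set \<Rightarrow> 'a set \<Rightarrow> ennreal" where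
  "fill_distance \<Omega> X = (SUP x\<in>\<Omega>. ennreal (infdist x X))"

text \<open>For a single site the separation radius is \<open>\<infinity>\<close>, so a singleton is not quasi-uniform in a
  bounded \<open>\<Omega>\<close>; no samplet with vanishing moments lives on one site anyway.\<close>

definition separation_radius :: "'a::metric_space set \<Rightarrow> ennreal" where
  "separation_radius X = (INF (x, y)\<in>{(x, y). x \<in> X \<and> y \<in> X \<and> x \<noteq> y}. ennreal (dist x y / 2))"

definition quasi_uniform :: "real \<Rightarrow> 'a::metric_space set \<Rightarrow> 'a set \<Rightarrow> bool" where
  "quasi_uniform \<gamma> \<Omega> X \<longleftrightarrow>
     fill_distance \<Omega> X \<le> ennreal \<gamma> * separation_radius X \<and>
     separation_radius X \<le> ennreal \<gamma> * fill_distance \<Omega> X"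

text \<open>A node carries its cluster and its children, so that nodes on different levels stay
  distinct even if their clusters coincide as sets.\<close>

datatype 'a ctree = Cluster (sites: "'a set") (children: "'a ctree list")

primrec nodes :: "nat \<Rightarrow> 'a ctree \<Rightarrow> 'a ctree set" where
  "nodes 0 t = {t}"
| "nodes (Suc j) t = (\<Union>s\<in>set (children t). nodes j s)"

definition depth :: "'a ctree \<Rightarrow> nat" where
  "depth t = Max {j. nodes j t \<noteq> {}}"

definition cluster_tree :: "'a set \<Rightarrow> 'a ctree \<Rightarrow> bool" where
  "cluster_tree X t \<longleftrightarrow> sites t = X \<and>
     (\<forall>j. \<forall>s\<in>nodes j t. children s \<noteq> [] \<longrightarrow>
        sites s = (\<Union>c\<in>set (children s). sites c) \<and>
        disjoint_family_on (\<lambda>i. sites (children s ! i)) {..<length (children s)})"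

definition two_pow_d_tree :: "(real ^ 'n::finite) ctree \<Rightarrow> bool" where
  "two_pow_d_tree t \<longleftrightarrow> (\<forall>j<depth t. \<forall>s\<in>nodes j t. length (children s) = 2 ^ CARD('n))"

definition balanced :: "real \<Rightarrow> (real ^ 'n::finite) ctree \<Rightarrow> bool" where
  "balanced c t \<longleftrightarrow> (\<forall>j. \<forall>s\<in>nodes j t.
     real (card (sites s)) \<le> c * (real (card (sites t)) * 2 powr - (real j * real CARD('n))) \<and>
     real (card (sites t)) * 2 powr - (real j * real CARD('n)) \<le> c * real (card (sites s)))"

text \<open>Geometric clustering in the box \<open>[a, b]\<close>: every edge is halved, and the \<open>2 ^ d\<close> children
  correspond to the subboxes, indexed by the set \<open>u i\<close> of coordinates in which the upper half is
  taken. Sites on a common face of closed subboxes may go to any one of them.\<close>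

inductive geometric :: "real ^ 'n::finite \<Rightarrow> real ^ 'n \<Rightarrow> (real ^ 'n) ctree \<Rightarrow> bool" where
  leaf: "A \<subseteq> cbox a b \<Longrightarrow> geometric a b (Cluster A [])"
| split: "\<lbrakk>A \<subseteq> cbox a b; bij_betw u {..<length ts} (UNIV :: 'n set set);
     \<And>i. i < length ts \<Longrightarrow>
       geometric (\<chi> k. if k \<in> u i then (a $ k + b $ k) / 2 else a $ k)
                 (\<chi> k. if k \<in> u i then b $ k else (a $ k + b $ k) / 2) (ts ! i)\<rbrakk>
   \<Longrightarrow> geometric a b (Cluster A ts)"


section \<open>Samplets\<close>

text \<open>A functional \<open>\<Sum>x\<in>X. \<omega> x \<cdot> \<delta>\<^sub>x\<close> is represented by its weights \<open>\<omega>\<close>.\<close>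

definition dirac :: "'a \<Rightarrow> 'a \<Rightarrow> real" where
  "dirac x = (\<lambda>y. if y = x then 1 else 0)"

definition pairing :: "'a set \<Rightarrow> ('a \<Rightarrow> real) \<Rightarrow> ('a \<Rightarrow> real) \<Rightarrow> real" where
  "pairing X \<omega> f = (\<Sum>x\<in>X. \<omega> x * f x)"

text \<open>\<open>Q\<close> is the orthogonal \<open>n \<times> n\<close> factor of a QR decomposition of the \<open>n \<times> r\<close> matrix \<open>A\<close>.\<close>

definition qr_orthogonal_factor ::
    "nat \<Rightarrow> nat \<Rightarrow> (nat \<Rightarrow> nat \<Rightarrow> real) \<Rightarrow> (nat \<Rightarrow> nat \<Rightarrow> real) \<Rightarrow> bool" where
  "qr_orthogonal_factor n r A Q \<longleftrightarrow>
     (\<forall>i<n. \<forall>j<n. (\<Sum>k<n. Q k i * Q k j) = (if i = j then 1 else 0)) \<and>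
     (\<exists>T. (\<forall>i<n. \<forall>l<r. l < i \<longrightarrow> T i l = 0) \<and>
          (\<forall>k<n. \<forall>l<r. A k l = (\<Sum>i<n. Q k i * T i l)))"

text \<open>One step of the construction, with the row \<open>\<Psi>\<close> of distributions collected from the
  children: \<open>[\<Phi>, \<Sigma>] = \<Psi> [Q\<^sub>\<Phi>, Q\<^sub>\<Sigma>]\<close>. The list \<open>bs\<close> enumerates the multi-indices of the moments,
  and \<open>p\<close> is the number of columns of \<open>Q\<^sub>\<Phi>\<close>; it is left open, as the vanishing moments of the
  samplets are a separate requirement.\<close>

definition samplet_step ::
    "(real ^ 'n::finite) set \<Rightarrow> ('n \<Rightarrow> nat) list \<Rightarrow> (real ^ 'n \<Rightarrow> real) list \<Rightarrow>
     (real ^ 'n \<Rightarrow> real) list \<Rightarrow> (real ^ 'n \<Rightarrow> real) list \<Rightarrow> bool" where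
  "samplet_step X bs \<Psi> Ph Sg \<longleftrightarrow> (\<exists>Q p.
     qr_orthogonal_factor (length \<Psi>) (length bs)
       (\<lambda>k l. pairing X (\<Psi> ! k) (monomial (bs ! l))) Q \<and>
     p \<le> length \<Psi> \<and>
     Ph = map (\<lambda>i x. \<Sum>k<length \<Psi>. Q k i * (\<Psi> ! k) x) [0..<p] \<and>
     Sg = map (\<lambda>i x. \<Sum>k<length \<Psi>. Q k i * (\<Psi> ! k) x) [p..<length \<Psi>])"

text \<open>\<open>Ph s\<close> and \<open>Sg s\<close> list the scaling distributions and the samplets of the node \<open>s\<close>.\<close>

definition samplet_system ::
    "(real ^ 'n::finite) set \<Rightarrow> nat \<Rightarrow> (real ^ 'n) ctree \<Rightarrow>
     ((real ^ 'n) ctree \<Rightarrow> (real ^ 'n \<Rightarrow> real) list) \<Rightarrow>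
     ((real ^ 'n) ctree \<Rightarrow> (real ^ 'n \<Rightarrow> real) list) \<Rightarrow> bool" where
  "samplet_system X q t Ph Sg \<longleftrightarrow> (\<exists>bs. distinct bs \<and> set bs = {\<beta>. mi_abs \<beta> \<le> q} \<and>
     (\<forall>j. \<forall>s\<in>nodes j t. \<exists>\<Psi>.
        (if children s = []
         then \<exists>xs. distinct xs \<and> set xs = sites s \<and> \<Psi> = map dirac xs
         else \<Psi> = concat (map Ph (children s))) \<and>
        samplet_step X bs \<Psi> (Ph s) (Sg s)))"

definition vanishing_moments ::
    "(real ^ 'n::finite) set \<Rightarrow> nat \<Rightarrow> (real ^ 'n) ctree \<Rightarrow>
     ((real ^ 'n) ctree \<Rightarrow> (real ^ 'n \<Rightarrow> real) list) \<Rightarrow> bool" where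
  "vanishing_moments X q t Sg \<longleftrightarrow>
     (\<forall>j. \<forall>s\<in>nodes j t. \<forall>\<sigma>\<in>set (Sg s). \<forall>p\<in>polys q. pairing X \<sigma> p = 0)"

end

theory Submission
  imports Defs
begin

text \<open>
  The idea is Taylor expansion at \<open>x0\<close> against vanishing moments. On the ball, \<open>f\<close> differs from
  its Taylor polynomial \<open>p\<close> of degree \<open>m\<close> by at most a constant times
  \<open>norm (x - x0) powr (\<theta> + m)\<close>. Away from the ball the same bound costs nothing:
  there \<open>norm (x - x0)\<close> exceeds \<open>R\<close>, so every lower power of it, and every constant, is bounded by
  a multiple of the power \<open>\<theta> + m\<close>; this controls \<open>p\<close> and the values of \<open>f\<close> bounded by \<open>M\<close>
  (\<open>taylor_approximation\<close>). The constant is thus determined by \<open>f\<close>, \<open>x0\<close>, \<open>R\<close>,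
  \<open>M\<close>, \<open>m\<close> and \<open>\<theta>\<close>, independently of the sites, the tree and the samplets.

  A samplet of a cluster is a unit vector supported on the cluster: the construction starts from
  Dirac functionals, collects families with disjoint supports and applies orthogonal matrices, and
  each of these steps preserves orthonormality (\<open>orthonormal_construction\<close>). As the samplet
  annihilates \<open>p\<close>, it may be paired with \<open>f - p\<close> instead of \<open>f\<close>; every site of the cluster has
  distance at most the diameter from \<open>x0\<close>, and the Cauchy-Schwarz inequality turns the unit
  \<open>\<ell>\<^sup>2\<close>-norm of the weights into the factor \<open>sqrt (card (sites s))\<close>.

  For the second bound, a cluster on level \<open>j\<close> lies in a cube of side length \<open>1 / 2 ^ j\<close>, which
  bounds its diameter, and balance bounds its cardinality. The square root of the balance
  constant enters the overall constant.
\<close>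

section \<open>Polynomials\<close>

lemma finite_mi_abs_le: "finite {\<beta> :: 'n::finite \<Rightarrow> nat. mi_abs \<beta> \<le> q}"
proof (rule finite_subset)
  show "{\<beta> :: 'n \<Rightarrow> nat. mi_abs \<beta> \<le> q} \<subseteq> PiE UNIV (\<lambda>_. {..q})"
  proof clarify
    fix \<beta> :: "'n \<Rightarrow> nat" assume "mi_abs \<beta> \<le> q"
    moreover have "\<beta> i \<le> mi_abs \<beta>" for i
      unfolding mi_abs_def by (rule member_le_sum) auto
    ultimately show "\<beta> \<in> PiE UNIV (\<lambda>_. {..q})"
      by (auto intro: order_trans)
  qed
qed (intro finite_PiE; simp)

lemma mi_abs_Suc: "mi_abs (\<beta>(i := Suc (\<beta> i))) = Suc (mi_abs \<beta>)"
proof -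
  have "mi_abs (\<beta>(i := Suc (\<beta> i))) = (\<Sum>k\<in>UNIV. \<beta> k + (if k = i then 1 else 0))"
    unfolding mi_abs_def by (intro sum.cong) auto
  then show ?thesis
    by (simp add: sum.distrib mi_abs_def)
qed

lemma monomial_Suc: "monomial (\<beta>(i := Suc (\<beta> i))) x = x $ i * monomial \<beta> x"
proof -
  have "monomial (\<beta>(i := Suc (\<beta> i))) x = (\<Prod>k\<in>UNIV. x $ k ^ \<beta> k * (if k = i then x $ i else 1))"
    unfolding monomial_def by (intro prod.cong) auto
  then show ?thesis
    by (simp add: prod.distrib monomial_def)
qed

lemma polys_zero: "(\<lambda>_. 0) \<in> polys q"
  unfolding polys_def by (auto intro!: exI[of _ "\<lambda>_. 0"])

lemma polys_add: "p \<in> polys q \<Longrightarrow> r \<in> polys q \<Longrightarrow> (\<lambda>x. p x + r x) \<in> polys q"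
  unfolding polys_def
proof clarify
  fix c c' :: "('a \<Rightarrow> nat) \<Rightarrow> real"
  show "\<exists>d. (\<lambda>x. (\<Sum>\<beta> | mi_abs \<beta> \<le> q. c \<beta> * monomial \<beta> x) +
      (\<Sum>\<beta> | mi_abs \<beta> \<le> q. c' \<beta> * monomial \<beta> x)) = (\<lambda>x. \<Sum>\<beta> | mi_abs \<beta> \<le> q. d \<beta> * monomial \<beta> x)"
    by (rule exI[of _ "\<lambda>\<beta>. c \<beta> + c' \<beta>"]) (simp add: sum.distrib distrib_right)
qed

lemma polys_scale: "p \<in> polys q \<Longrightarrow> (\<lambda>x. a * p x) \<in> polys q"
  unfolding polys_def
proof clarify
  fix c :: "('a \<Rightarrow> nat) \<Rightarrow> real"
  show "\<exists>d. (\<lambda>x. a * (\<Sum>\<beta> | mi_abs \<beta> \<le> q. c \<beta> * monomial \<beta> x))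
      = (\<lambda>x. \<Sum>\<beta> | mi_abs \<beta> \<le> q. d \<beta> * monomial \<beta> x)"
    by (rule exI[of _ "\<lambda>\<beta>. a * c \<beta>"]) (simp add: sum_distrib_left mult.assoc)
qed

lemma polys_sum:
  assumes "finite I" "\<And>i. i \<in> I \<Longrightarrow> p i \<in> polys q"
  shows "(\<lambda>x. \<Sum>i\<in>I. p i x) \<in> polys q"
  using assms by (induction I rule: finite_induct) (auto intro: polys_zero polys_add)

lemma monomial_in_polys:
  assumes "mi_abs \<beta> \<le> q"
  shows "monomial \<beta> \<in> polys q"
proof -
  have "monomial \<beta> x = (\<Sum>\<alpha> | mi_abs \<alpha> \<le> q. (if \<alpha> = \<beta> then 1 else 0) * monomial \<alpha> x)" for x
  proof -
    have "(\<Sum>\<alpha> | mi_abs \<alpha> \<le> q. (if \<alpha> = \<beta> then 1 else 0) * monomial \<alpha> x)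
        = (\<Sum>\<alpha> | mi_abs \<alpha> \<le> q. if \<alpha> = \<beta> then monomial \<alpha> x else 0)"
      by (intro sum.cong) auto
    also have "\<dots> = monomial \<beta> x"
      using assms by (simp add: finite_mi_abs_le)
    finally show ?thesis by simp
  qed
  then show ?thesis
    unfolding polys_def by (intro CollectI exI[of _ "\<lambda>\<alpha>. if \<alpha> = \<beta> then 1 else 0"] ext)
qed

lemma polys_mono:
  assumes "p \<in> polys q" "q \<le> r"
  shows "p \<in> polys r"
proof -
  obtain c where "p = (\<lambda>x. \<Sum>\<beta> | mi_abs \<beta> \<le> q. c \<beta> * monomial \<beta> x)"
    using assms(1) unfolding polys_def by auto
  then show ?thesis
    using assms(2) by (auto intro!: polys_sum finite_mi_abs_le polys_scale monomial_in_polys)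
qed

lemma polys_const: "(\<lambda>_. a) \<in> polys q"
proof -
  have "(\<lambda>x. a * monomial (\<lambda>_. 0) x) \<in> polys q"
    by (intro polys_scale monomial_in_polys) (simp add: mi_abs_def)
  then show ?thesis by (simp add: monomial_def)
qed

lemma polys_mult_coordinate:
  assumes "p \<in> polys q"
  shows "(\<lambda>x. (x $ i - a) * p x) \<in> polys (Suc q)"
proof -
  obtain c where p: "p = (\<lambda>x. \<Sum>\<beta> | mi_abs \<beta> \<le> q. c \<beta> * monomial \<beta> x)"
    using assms unfolding polys_def by auto
  have "(\<lambda>x. \<Sum>\<beta> | mi_abs \<beta> \<le> q. c \<beta> * monomial (\<beta>(i := Suc (\<beta> i))) x) \<in> polys (Suc q)"
    by (auto intro!: polys_sum finite_mi_abs_le polys_scale monomial_in_polys simp: mi_abs_Suc)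
  moreover have "(\<lambda>x. - a * p x) \<in> polys (Suc q)"
    using assms by (intro polys_scale) (auto intro: polys_mono)
  ultimately have "(\<lambda>x. (\<Sum>\<beta> | mi_abs \<beta> \<le> q. c \<beta> * monomial (\<beta>(i := Suc (\<beta> i))) x) + - a * p x)
      \<in> polys (Suc q)"
    by (rule polys_add)
  moreover have "(\<Sum>\<beta> | mi_abs \<beta> \<le> q. c \<beta> * monomial (\<beta>(i := Suc (\<beta> i))) x) = x $ i * p x" for x
    unfolding p monomial_Suc by (simp add: sum_distrib_left mult_ac)
  ultimately show ?thesis
    by (simp add: left_diff_distrib)
qed


section \<open>Taylor expansion in Hoelder spaces\<close>

text \<open>The homogeneous part of degree \<open>k\<close> of the Taylor polynomial of \<open>D \<beta>\<close> at \<open>x0\<close>, that is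
  \<open>\<Sum>\<^bsub>|\<alpha>| = k\<^esub> D (\<beta> + \<alpha>) x0 * h\<^sup>\<alpha> / \<alpha>!\<close>. Euler's identity for homogeneous functions gives
  this recursion, which spares the factorials of multi-indices.\<close>

fun taylor_part ::
    "(('n::finite \<Rightarrow> nat) \<Rightarrow> real ^ 'n \<Rightarrow> real) \<Rightarrow> real ^ 'n \<Rightarrow> nat \<Rightarrow> ('n \<Rightarrow> nat) \<Rightarrow> real ^ 'n \<Rightarrow> real"
  where
  "taylor_part D x0 0 \<beta> h = D \<beta> x0"
| "taylor_part D x0 (Suc k) \<beta> h =
     (\<Sum>i\<in>UNIV. h $ i * taylor_part D x0 k (\<beta>(i := Suc (\<beta> i))) h) / real (Suc k)"

lemma taylor_part_polys: "(\<lambda>x. taylor_part D x0 k \<beta> (x - x0)) \<in> polys k"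
proof (induction k arbitrary: \<beta>)
  case 0
  show ?case by (simp add: polys_const)
next
  case (Suc k)
  have "(\<lambda>x. inverse (real (Suc k)) *
      (\<Sum>i\<in>UNIV. (x $ i - x0 $ i) * taylor_part D x0 k (\<beta>(i := Suc (\<beta> i))) (x - x0))) \<in> polys (Suc k)"
    by (intro polys_scale polys_sum polys_mult_coordinate Suc.IH) simp
  then show ?case
    by (simp add: divide_inverse mult.commute)
qed

lemma taylor_part_bound: "\<exists>C\<ge>0. \<forall>h. \<bar>taylor_part D x0 k \<beta> h\<bar> \<le> C * norm h ^ k"
proof (induction k arbitrary: \<beta>)
  case 0
  show ?case by (auto intro: exI[of _ "\<bar>D \<beta> x0\<bar>"])
next
  case (Suc k)
  have "\<forall>i. \<exists>C\<ge>0. \<forall>h. \<bar>taylor_part D x0 k (\<beta>(i := Suc (\<beta> i))) h\<bar> \<le> C * norm h ^ k"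
    using Suc.IH by blast
  then obtain C where C: "\<And>i. C i \<ge> 0"
    "\<And>i h. \<bar>taylor_part D x0 k (\<beta>(i := Suc (\<beta> i))) h\<bar> \<le> C i * norm h ^ k"
    by metis
  have "\<bar>taylor_part D x0 (Suc k) \<beta> h\<bar> \<le> (\<Sum>i\<in>UNIV. C i) * norm h ^ Suc k" for h
  proof -
    have "\<bar>taylor_part D x0 (Suc k) \<beta> h\<bar>
        \<le> \<bar>\<Sum>i\<in>UNIV. h $ i * taylor_part D x0 k (\<beta>(i := Suc (\<beta> i))) h\<bar>"
      by (simp add: abs_divide divide_le_eq mult_left_le add_increasing2 algebra_simps)
    also have "\<dots> \<le> (\<Sum>i\<in>UNIV. \<bar>h $ i\<bar> * \<bar>taylor_part D x0 k (\<beta>(i := Suc (\<beta> i))) h\<bar>)"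
      unfolding abs_mult[symmetric] by (rule sum_abs)
    also have "\<dots> \<le> (\<Sum>i\<in>UNIV. norm h * (C i * norm h ^ k))"
      by (intro sum_mono mult_mono C component_le_norm_cart) auto
    also have "\<dots> = (\<Sum>i\<in>UNIV. C i) * norm h ^ Suc k"
      by (simp add: sum_distrib_left sum_distrib_right mult_ac)
    finally show ?thesis .
  qed
  with C(1) show ?case
    by (intro exI[of _ "\<Sum>i\<in>UNIV. C i"]) (auto intro: sum_nonneg)
qed

lemma taylor_part_homogeneous: "taylor_part D x0 k \<beta> (t *\<^sub>R h) = t ^ k * taylor_part D x0 k \<beta> h"
  by (induction k arbitrary: \<beta>) (simp_all add: sum_distrib_left mult_ac)

text \<open>The remainder of \<open>D \<beta>\<close> restricted to the segment from \<open>x0\<close> in the direction \<open>h\<close> vanishes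
  at the start. Its derivative is a combination, with the components of \<open>h\<close> as coefficients, of
  the remainders of the functions \<open>D (\<beta> + e\<^sub>i)\<close> of one order less. So the mean value
  theorem gains one power of \<open>norm h\<close> per differentiation, and the Hoelder condition on the highest
  derivatives provides the start of the induction.\<close>

lemma taylor_remainder:
  assumes D: "partial_derivatives m (cball x0 R) f D"
    and L: "\<And>\<beta> x. mi_abs \<beta> = m \<Longrightarrow> x \<in> cball x0 R \<Longrightarrow>
              \<bar>D \<beta> x - D \<beta> x0\<bar> \<le> L * norm (x - x0) powr \<theta>"
    and "0 < \<theta>" "mi_abs \<beta> + k = m"
  shows "\<exists>C\<ge>0. \<forall>h. norm h \<le> R \<longrightarrow>
           \<bar>D \<beta> (x0 + h) - (\<Sum>l\<le>k. taylor_part D x0 l \<beta> h)\<bar> \<le> C * norm h powr (\<theta> + real k)"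
  using assms(4)
proof (induction k arbitrary: \<beta>)
  case 0
  have "\<bar>D \<beta> (x0 + h) - D \<beta> x0\<bar> \<le> \<bar>L\<bar> * norm h powr \<theta>" if "norm h \<le> R" for h
  proof -
    have "\<bar>D \<beta> (x0 + h) - D \<beta> x0\<bar> \<le> L * norm h powr \<theta>"
      using L[of \<beta> "x0 + h"] 0 that by (simp add: dist_norm)
    also have "\<dots> \<le> \<bar>L\<bar> * norm h powr \<theta>"
      by (intro mult_right_mono) auto
    finally show ?thesis .
  qed
  then show ?case by (intro exI[of _ "\<bar>L\<bar>"]) simp
next
  case (Suc k)
  define \<beta>' where "\<beta>' i = \<beta>(i := Suc (\<beta> i))" for i
  define E where "E k \<beta> h = D \<beta> (x0 + h) - (\<Sum>l\<le>k. taylor_part D x0 l \<beta> h)" for k \<beta> h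
  have "mi_abs (\<beta>' i) + k = m" for i
    using Suc.prems by (simp add: \<beta>'_def mi_abs_Suc)
  then have "\<forall>i. \<exists>C\<ge>0. \<forall>h. norm h \<le> R \<longrightarrow> \<bar>E k (\<beta>' i) h\<bar> \<le> C * norm h powr (\<theta> + real k)"
    using Suc.IH unfolding E_def by blast
  then obtain C where C: "\<And>i. C i \<ge> 0"
    "\<And>i h. norm h \<le> R \<Longrightarrow> \<bar>E k (\<beta>' i) h\<bar> \<le> C i * norm h powr (\<theta> + real k)"
    by metis
  have "\<bar>E (Suc k) \<beta> h\<bar> \<le> (\<Sum>i\<in>UNIV. C i) * norm h powr (\<theta> + real (Suc k))" if h: "norm h \<le> R" for h
  proof -
    have th: "norm (t *\<^sub>R h) \<le> norm h" if "t \<in> {0..1}" for t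
      using that by (simp add: mult_left_le_one_le)
    have E': "((\<lambda>t. E (Suc k) \<beta> (t *\<^sub>R h)) has_derivative
        (\<lambda>s. s * (\<Sum>i\<in>UNIV. h $ i * E k (\<beta>' i) (t *\<^sub>R h)))) (at t within {0..1})"
      if t: "t \<in> {0..1}" for t
    proof -
      have in_ball: "x0 + t *\<^sub>R h \<in> cball x0 R" if "t \<in> {0..1}" for t
        using th[OF that] h by (simp add: dist_norm)
      have "(D \<beta> has_derivative (\<lambda>v. \<Sum>i\<in>UNIV. D (\<beta>' i) (x0 + t *\<^sub>R h) * v $ i))
          (at (x0 + t *\<^sub>R h) within (\<lambda>t. x0 + t *\<^sub>R h) ` {0..1})"
      proof (rule has_derivative_subset[where s = "cball x0 R"])
        show "(D \<beta> has_derivative (\<lambda>v. \<Sum>i\<in>UNIV. D (\<beta>' i) (x0 + t *\<^sub>R h) * v $ i))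
            (at (x0 + t *\<^sub>R h) within cball x0 R)"
          using D in_ball[OF t] Suc.prems unfolding partial_derivatives_def \<beta>'_def by simp
      qed (use in_ball in blast)
      moreover have "((\<lambda>t. x0 + t *\<^sub>R h) has_derivative (\<lambda>s. s *\<^sub>R h)) (at t within {0..1})"
        by (auto intro!: derivative_eq_intros)
      ultimately have 1: "((\<lambda>t. D \<beta> (x0 + t *\<^sub>R h)) has_derivative
          (\<lambda>s. \<Sum>i\<in>UNIV. D (\<beta>' i) (x0 + t *\<^sub>R h) * (s *\<^sub>R h) $ i)) (at t within {0..1})"
        by (rule has_derivative_in_compose[rotated,
              where g = "D \<beta>" and f = "\<lambda>t. x0 + t *\<^sub>R h"])
      have pow: "((\<lambda>t. t ^ Suc l * a) has_derivative (\<lambda>s. s * real (Suc l) * t ^ l * a)) (at t within {0..1})"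
        for l and a :: real
        by (rule has_derivative_eq_rhs[OF DERIV_cmult_right[OF DERIV_pow, unfolded has_field_derivative_def]])
          (auto simp: fun_eq_iff)
      have "((\<lambda>t. D \<beta> x0 + (\<Sum>l\<le>k. t ^ Suc l * taylor_part D x0 (Suc l) \<beta> h)) has_derivative
          (\<lambda>s. \<Sum>l\<le>k. s * real (Suc l) * t ^ l * taylor_part D x0 (Suc l) \<beta> h)) (at t within {0..1})"
        by (rule has_derivative_eq_rhs[OF has_derivative_add[OF has_derivative_const
              has_derivative_sum[OF pow]]]) simp
      then have 2: "((\<lambda>t. \<Sum>l\<le>Suc k. taylor_part D x0 l \<beta> (t *\<^sub>R h)) has_derivative
          (\<lambda>s. \<Sum>l\<le>k. s * real (Suc l) * t ^ l * taylor_part D x0 (Suc l) \<beta> h)) (at t within {0..1})"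
        by (simp add: sum.atMost_Suc_shift taylor_part_homogeneous del: sum.atMost_Suc of_nat_Suc
            taylor_part.simps(2))
      have "(\<Sum>i\<in>UNIV. D (\<beta>' i) (x0 + t *\<^sub>R h) * (s *\<^sub>R h) $ i)
          - (\<Sum>l\<le>k. s * real (Suc l) * t ^ l * taylor_part D x0 (Suc l) \<beta> h)
          = s * (\<Sum>i\<in>UNIV. h $ i * E k (\<beta>' i) (t *\<^sub>R h))" for s
      proof -
        have "(\<Sum>l\<le>k. s * real (Suc l) * t ^ l * taylor_part D x0 (Suc l) \<beta> h)
            = (\<Sum>l\<le>k. \<Sum>i\<in>UNIV. s * h $ i * (t ^ l * taylor_part D x0 l (\<beta>' i) h))"
        proof (rule sum.cong[OF refl])
          fix l
          \<comment> \<open>The factor from differentiating the power of \<open>t\<close> cancels the divisor in \<open>taylor_part\<close>.\<close>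
          have euler: "real (Suc l) * taylor_part D x0 (Suc l) \<beta> h
              = (\<Sum>i\<in>UNIV. h $ i * taylor_part D x0 l (\<beta>' i) h)"
            by (simp add: \<beta>'_def del: of_nat_Suc)
          have "s * real (Suc l) * t ^ l * taylor_part D x0 (Suc l) \<beta> h
              = s * t ^ l * (real (Suc l) * taylor_part D x0 (Suc l) \<beta> h)"
            by (simp only: mult_ac)
          then show "s * real (Suc l) * t ^ l * taylor_part D x0 (Suc l) \<beta> h
              = (\<Sum>i\<in>UNIV. s * h $ i * (t ^ l * taylor_part D x0 l (\<beta>' i) h))"
            unfolding euler by (simp add: sum_distrib_left mult_ac)
        qed
        also have "\<dots> = (\<Sum>i\<in>UNIV. s * h $ i * (\<Sum>l\<le>k. t ^ l * taylor_part D x0 l (\<beta>' i) h))"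
          by (subst sum.swap) (simp add: sum_distrib_left)
        finally have parts: "(\<Sum>l\<le>k. s * real (Suc l) * t ^ l * taylor_part D x0 (Suc l) \<beta> h)
            = (\<Sum>i\<in>UNIV. s * h $ i * (\<Sum>l\<le>k. t ^ l * taylor_part D x0 l (\<beta>' i) h))" .
        have "s * (\<Sum>i\<in>UNIV. h $ i * E k (\<beta>' i) (t *\<^sub>R h))
            = (\<Sum>i\<in>UNIV. s * (h $ i * E k (\<beta>' i) (t *\<^sub>R h)))"
          by (rule sum_distrib_left)
        also have "\<dots> = (\<Sum>i\<in>UNIV. D (\<beta>' i) (x0 + t *\<^sub>R h) * (s *\<^sub>R h) $ i
            - s * h $ i * (\<Sum>l\<le>k. t ^ l * taylor_part D x0 l (\<beta>' i) h))"
          by (intro sum.cong refl)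
            (simp add: E_def taylor_part_homogeneous right_diff_distrib mult_ac)
        finally show ?thesis
          unfolding parts by (simp only: sum_subtractf)
      qed
      then show ?thesis
        using has_derivative_diff[OF 1 2] by (simp add: E_def)
    qed
    obtain t where t: "t \<in> {0..1}"
      and "E (Suc k) \<beta> (1 *\<^sub>R h) - E (Suc k) \<beta> (0 *\<^sub>R h)
        = (1 - 0) * (\<Sum>i\<in>UNIV. h $ i * E k (\<beta>' i) (t *\<^sub>R h))"
      using mvt_very_simple[of 0 1 "\<lambda>t. E (Suc k) \<beta> (t *\<^sub>R h)"
          "\<lambda>t s. s * (\<Sum>i\<in>UNIV. h $ i * E k (\<beta>' i) (t *\<^sub>R h))"] E' by auto
    moreover have "E (Suc k) \<beta> (0 *\<^sub>R h) = 0"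
      unfolding E_def taylor_part_homogeneous
      by (simp add: sum.atMost_Suc_shift del: sum.atMost_Suc)
    ultimately have "\<bar>E (Suc k) \<beta> h\<bar> = \<bar>\<Sum>i\<in>UNIV. h $ i * E k (\<beta>' i) (t *\<^sub>R h)\<bar>"
      by simp
    also have "\<dots> \<le> (\<Sum>i\<in>UNIV. \<bar>h $ i\<bar> * \<bar>E k (\<beta>' i) (t *\<^sub>R h)\<bar>)"
      unfolding abs_mult[symmetric] by (rule sum_abs)
    also have "\<dots> \<le> (\<Sum>i\<in>UNIV. norm h * (C i * norm h powr (\<theta> + real k)))"
    proof (intro sum_mono mult_mono component_le_norm_cart)
      fix i
      have "\<bar>E k (\<beta>' i) (t *\<^sub>R h)\<bar> \<le> C i * norm (t *\<^sub>R h) powr (\<theta> + real k)"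
        using th[OF t] h by (intro C) linarith
      also have "\<dots> \<le> C i * norm h powr (\<theta> + real k)"
        using th[OF t] \<open>0 < \<theta>\<close> by (intro mult_left_mono powr_mono2 C) auto
      finally show "\<bar>E k (\<beta>' i) (t *\<^sub>R h)\<bar> \<le> C i * norm h powr (\<theta> + real k)" .
    qed auto
    also have "\<dots> = (\<Sum>i\<in>UNIV. C i) * (norm h * norm h powr (\<theta> + real k))"
      by (simp add: sum_distrib_left sum_distrib_right mult_ac)
    also have "norm h * norm h powr (\<theta> + real k) = norm h powr (\<theta> + real (Suc k))"
      by (simp add: powr_mult_base add_ac)
    finally show ?thesis .
  qed
  with C(1) show ?case
    unfolding E_def by (intro exI[of _ "\<Sum>i\<in>UNIV. C i"]) (auto intro: sum_nonneg)
qed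

lemma power_le_powr_outside:
  assumes "0 < R" "R \<le> r" "real l \<le> a"
  shows "r ^ l \<le> R powr (real l - a) * r powr a"
proof -
  have "r ^ l = r powr (real l - a) * r powr a"
    using assms by (simp add: powr_add[symmetric] powr_realpow)
  also have "\<dots> \<le> R powr (real l - a) * r powr a"
    using assms by (intro mult_right_mono powr_mono2') auto
  finally show ?thesis .
qed

text \<open>Outside the ball neither Taylor's formula nor any smoothness is available. There the estimate
  merely compares sizes: \<open>norm (x - x0)\<close> is at least \<open>R\<close>, hence its power \<open>\<theta> + m\<close> dominates
  constants and the homogeneous parts of \<open>p\<close>, whose degrees are at most \<open>m\<close>. This covers clusters
  that reach out of the ball.\<close>

lemma taylor_approximation:
  assumes f: "f \<in> holder_space m \<theta> (cball x0 R)" and "0 < \<theta>" "0 < R"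
  obtains p C where "p \<in> polys m" "0 \<le> C"
    "\<And>x. x \<in> cball x0 R \<or> \<bar>f x\<bar> \<le> M \<Longrightarrow> \<bar>f x - p x\<bar> \<le> C * norm (x - x0) powr (\<theta> + real m)"
proof -
  obtain D L where D: "partial_derivatives m (cball x0 R) f D"
    and L: "\<And>\<beta> x y. mi_abs \<beta> = m \<Longrightarrow> x \<in> cball x0 R \<Longrightarrow> y \<in> cball x0 R \<Longrightarrow>
              \<bar>D \<beta> x - D \<beta> y\<bar> \<le> L * norm (x - y) powr \<theta>"
    using f unfolding holder_space_def by blast
  define p where "p x = (\<Sum>l\<le>m. taylor_part D x0 l (\<lambda>_. 0) (x - x0))" for x
  define a where "a = \<theta> + real m"
  have "p \<in> polys m"
    unfolding p_def by (intro polys_sum polys_mono[OF taylor_part_polys]) auto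
  have "\<exists>C\<ge>0. \<forall>h. norm h \<le> R \<longrightarrow>
      \<bar>D (\<lambda>_. 0) (x0 + h) - (\<Sum>l\<le>m. taylor_part D x0 l (\<lambda>_. 0) h)\<bar> \<le> C * norm h powr (\<theta> + real m)"
    by (rule taylor_remainder[OF D L]) (use assms in \<open>auto simp: mi_abs_def\<close>)
  then obtain C where "C \<ge> 0" and C: "\<And>h. norm h \<le> R \<Longrightarrow>
      \<bar>D (\<lambda>_. 0) (x0 + h) - (\<Sum>l\<le>m. taylor_part D x0 l (\<lambda>_. 0) h)\<bar> \<le> C * norm h powr a"
    unfolding a_def by blast
  obtain B where B: "\<And>l. B l \<ge> 0" "\<And>l h. \<bar>taylor_part D x0 l (\<lambda>_. 0) h\<bar> \<le> B l * norm h ^ l"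
    using taylor_part_bound[of D x0 _ "\<lambda>_. 0"] by metis
  \<comment> \<open>The additional constant for points outside the ball.\<close>
  define C' where "C' = \<bar>M\<bar> * R powr - a + (\<Sum>l\<le>m. B l * R powr (real l - a))"
  have "C' \<ge> 0"
    unfolding C'_def by (intro add_nonneg_nonneg sum_nonneg mult_nonneg_nonneg B) auto
  have "\<bar>f x - p x\<bar> \<le> (C + C') * norm (x - x0) powr a" if x: "x \<in> cball x0 R \<or> \<bar>f x\<bar> \<le> M" for x
  proof (cases "x \<in> cball x0 R")
    case True
    then have "\<bar>f x - p x\<bar> \<le> C * norm (x - x0) powr a"
      using C[of "x - x0"] D by (simp add: p_def partial_derivatives_def dist_norm norm_minus_commute)
    also have "\<dots> \<le> (C + C') * norm (x - x0) powr a"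
      using \<open>C' \<ge> 0\<close> by (intro mult_right_mono) auto
    finally show ?thesis .
  next
    case False
    define r where "r = norm (x - x0)"
    have R: "R \<le> r"
      using False by (simp add: r_def dist_norm norm_minus_commute)
    have pow: "r ^ l \<le> R powr (real l - a) * r powr a" if "l \<le> m" for l
      using that assms R by (intro power_le_powr_outside) (auto simp: a_def)
    have "\<bar>f x\<bar> \<le> \<bar>M\<bar> * r ^ 0"
      using x False by auto
    also have "\<dots> \<le> \<bar>M\<bar> * (R powr (real 0 - a) * r powr a)"
      by (intro mult_left_mono pow) auto
    finally have 1: "\<bar>f x\<bar> \<le> \<bar>M\<bar> * R powr - a * r powr a" by simp
    have "\<bar>p x\<bar> \<le> (\<Sum>l\<le>m. \<bar>taylor_part D x0 l (\<lambda>_. 0) (x - x0)\<bar>)"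
      unfolding p_def by (rule sum_abs)
    also have "\<dots> \<le> (\<Sum>l\<le>m. B l * r ^ l)"
      unfolding r_def by (intro sum_mono B)
    also have "\<dots> \<le> (\<Sum>l\<le>m. B l * (R powr (real l - a) * r powr a))"
      by (intro sum_mono mult_left_mono pow B) auto
    also have "\<dots> = (C' - \<bar>M\<bar> * R powr - a) * r powr a"
      by (simp add: C'_def sum_distrib_right mult.assoc)
    finally have "\<bar>f x - p x\<bar> \<le> C' * r powr a"
      using 1 by (simp add: left_diff_distrib)
    also have "\<dots> \<le> (C + C') * r powr a"
      using \<open>C \<ge> 0\<close> by (intro mult_right_mono) auto
    finally show ?thesis by (simp add: r_def)
  qed
  then show ?thesis
    using that[of p "C + C'"] \<open>p \<in> polys m\<close> \<open>C \<ge> 0\<close> \<open>C' \<ge> 0\<close> by (simp add: a_def)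
qed


section \<open>Orthonormality of the samplets\<close>

lemma nodes_trans: "s \<in> nodes j t \<Longrightarrow> u \<in> nodes i s \<Longrightarrow> u \<in> nodes (j + i) t"
  by (induction j arbitrary: t) auto

lemma cluster_subset:
  assumes "cluster_tree X t" "s \<in> nodes j t"
  shows "sites s \<subseteq> X"
  using assms(2)
proof (induction j arbitrary: s)
  case 0
  then show ?case using assms(1) by (simp add: cluster_tree_def)
next
  case (Suc j)
  \<comment> \<open>The recursion of \<open>nodes\<close> descends from the root, whereas the parent of \<open>s\<close> is needed.\<close>
  have "\<exists>u\<in>nodes j t. s \<in> set (children u)"
    using Suc.prems
  proof (induction j arbitrary: t)
    case (Suc j)
    then show ?case by fastforce
  qed simp
  then obtain u where u: "u \<in> nodes j t" "s \<in> set (children u)"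
    by blast
  then have "children u \<noteq> []" by auto
  then have "sites u = (\<Union>c\<in>set (children u). sites c)"
    using assms(1) u(1) unfolding cluster_tree_def by blast
  then show ?case using Suc.IH[OF u(1)] u(2) by blast
qed

text \<open>Orthonormality is demanded by position rather than for distinct members, so that
  repetitions in the list are excluded.\<close>

definition orthonormal_on :: "'a set \<Rightarrow> 'a set \<Rightarrow> ('a \<Rightarrow> real) list \<Rightarrow> bool" where
  "orthonormal_on X Y \<Psi> \<longleftrightarrow>
     (\<forall>\<psi>\<in>set \<Psi>. \<forall>x. x \<notin> Y \<longrightarrow> \<psi> x = 0) \<and>
     (\<forall>\<psi>\<in>set \<Psi>. pairing X \<psi> \<psi> = 1) \<and> sorted_wrt (\<lambda>\<phi> \<psi>. pairing X \<phi> \<psi> = 0) \<Psi>"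

lemma pairing_commute: "pairing X \<phi> \<psi> = pairing X \<psi> \<phi>"
  by (simp add: pairing_def mult.commute)

lemma orthonormal_on_nth:
  assumes "orthonormal_on X Y \<Psi>" "i < length \<Psi>" "j < length \<Psi>"
  shows "pairing X (\<Psi> ! i) (\<Psi> ! j) = (if i = j then 1 else 0)"
  using assms unfolding orthonormal_on_def sorted_wrt_iff_nth_less
  by (metis linorder_neqE_nat nth_mem pairing_commute)

lemma orthonormal_on_dirac:
  assumes "finite X" "set xs \<subseteq> X" "distinct xs"
  shows "orthonormal_on X (set xs) (map dirac xs)"
proof -
  have "pairing X (dirac x) (dirac y) = (if x = y then 1 else 0)" if "x \<in> X" for x y
  proof -
    have "pairing X (dirac x) (dirac y) = (\<Sum>z\<in>X. if z = x then if x = y then 1 else 0 else 0)"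
      unfolding pairing_def dirac_def by (intro sum.cong) auto
    then show ?thesis
      using that assms(1) by simp
  qed
  then have *: "pairing X (dirac (xs ! i)) (dirac (xs ! j)) = (if i = j then 1 else 0)"
    if "i < length xs" "j < length xs" for i j
    using that assms by (simp add: nth_eq_iff_index_eq subset_iff)
  show ?thesis
    unfolding orthonormal_on_def sorted_wrt_iff_nth_less
    using * by (auto simp: in_set_conv_nth dirac_def)
qed

lemma orthonormal_on_concat:
  assumes "\<And>c. c \<in> set cs \<Longrightarrow> orthonormal_on X (S c) (P c)"
    and "disjoint_family_on (\<lambda>i. S (cs ! i)) {..<length cs}"
  shows "orthonormal_on X (\<Union>c\<in>set cs. S c) (concat (map P cs))"
  using assms
proof (induction cs)
  case Nil
  show ?case by (simp add: orthonormal_on_def)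
next
  case (Cons c cs)
  have "disjoint_family_on (\<lambda>i. S (cs ! i)) {..<length cs}"
    unfolding disjoint_family_on_def
  proof (intro ballI impI)
    fix i j assume "i \<in> {..<length cs}" "j \<in> {..<length cs}" "i \<noteq> j"
    then show "S (cs ! i) \<inter> S (cs ! j) = {}"
      using disjoint_family_onD[OF Cons.prems(2), of "Suc i" "Suc j"] by simp
  qed
  with Cons have tl: "orthonormal_on X (\<Union>c\<in>set cs. S c) (concat (map P cs))"
    by simp
  have "S c \<inter> S d = {}" if d: "d \<in> set cs" for d
  proof -
    obtain i where "i < length cs" "cs ! i = d"
      using d by (auto simp: in_set_conv_nth)
    then show ?thesis
      using disjoint_family_onD[OF Cons.prems(2), of 0 "Suc i"] by simp
  qed
  then have disj: "S c \<inter> (\<Union>d\<in>set cs. S d) = {}" by blast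
  have hd: "orthonormal_on X (S c) (P c)"
    using Cons.prems(1) by simp
  have "pairing X \<phi> \<psi> = 0" if "\<phi> \<in> set (P c)" "\<psi> \<in> set (concat (map P cs))" for \<phi> \<psi>
  proof -
    have "\<phi> x = 0 \<or> \<psi> x = 0" for x
      using that disj hd tl unfolding orthonormal_on_def by blast
    then show ?thesis
      unfolding pairing_def by (intro sum.neutral) auto
  qed
  with hd tl show ?case
    unfolding orthonormal_on_def by (auto simp: sorted_wrt_append)
qed

lemma orthonormal_on_rotate:
  assumes \<Psi>: "orthonormal_on X Y \<Psi>"
    and Q: "\<And>i j. i < length \<Psi> \<Longrightarrow> j < length \<Psi> \<Longrightarrow>
              (\<Sum>k<length \<Psi>. Q k i * Q k j) = (if i = j then 1 else 0)"
  shows "orthonormal_on X Y (map (\<lambda>i x. \<Sum>k<length \<Psi>. Q k i * (\<Psi> ! k) x) [0..<length \<Psi>])"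
proof -
  define n where "n = length \<Psi>"
  define \<rho> where "\<rho> i x = (\<Sum>k<n. Q k i * (\<Psi> ! k) x)" for i x
  have \<rho>: "pairing X (\<rho> i) (\<rho> j) = (if i = j then 1 else 0)" if "i < n" "j < n" for i j
  proof -
    have "pairing X (\<rho> i) (\<rho> j)
        = (\<Sum>x\<in>X. \<Sum>k<n. \<Sum>l<n. Q k i * Q l j * ((\<Psi> ! k) x * (\<Psi> ! l) x))"
      by (simp add: pairing_def \<rho>_def sum_product mult_ac)
    also have "\<dots> = (\<Sum>k<n. \<Sum>x\<in>X. \<Sum>l<n. Q k i * Q l j * ((\<Psi> ! k) x * (\<Psi> ! l) x))"
      by (rule sum.swap)
    also have "\<dots> = (\<Sum>k<n. \<Sum>l<n. \<Sum>x\<in>X. Q k i * Q l j * ((\<Psi> ! k) x * (\<Psi> ! l) x))"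
      by (intro sum.cong refl sum.swap)
    also have "\<dots> = (\<Sum>k<n. \<Sum>l<n. Q k i * Q l j * pairing X (\<Psi> ! k) (\<Psi> ! l))"
      by (simp add: pairing_def sum_distrib_left)
    also have "\<dots> = (\<Sum>k<n. \<Sum>l<n. if l = k then Q k i * Q k j else 0)"
      by (intro sum.cong) (auto simp: orthonormal_on_nth[OF \<Psi>] n_def)
    also have "\<dots> = (\<Sum>k<n. Q k i * Q k j)"
      by simp
    finally show ?thesis
      using Q that by (simp add: n_def)
  qed
  have supp: "\<rho> i x = 0" if "x \<notin> Y" for i x
    unfolding \<rho>_def using \<Psi> that
    by (intro sum.neutral) (auto simp: orthonormal_on_def n_def)
  have "orthonormal_on X Y (map \<rho> [0..<n])"
    unfolding orthonormal_on_def sorted_wrt_iff_nth_less using \<rho> supp by auto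
  then show ?thesis
    by (simp add: \<rho>_def[abs_def] n_def)
qed

lemma samplet_step_orthonormal:
  assumes "samplet_step X bs \<Psi> Ph Sg" "orthonormal_on X Y \<Psi>"
  shows "orthonormal_on X Y (Ph @ Sg)"
proof -
  obtain Q p where Q: "qr_orthogonal_factor (length \<Psi>) (length bs)
       (\<lambda>k l. pairing X (\<Psi> ! k) (monomial (bs ! l))) Q"
    and p: "p \<le> length \<Psi>"
    and PS: "Ph = map (\<lambda>i x. \<Sum>k<length \<Psi>. Q k i * (\<Psi> ! k) x) [0..<p]"
       "Sg = map (\<lambda>i x. \<Sum>k<length \<Psi>. Q k i * (\<Psi> ! k) x) [p..<length \<Psi>]"
    using assms(1) unfolding samplet_step_def by blast
  have "[0..<p] @ [p..<length \<Psi>] = [0..<length \<Psi>]"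
    using p upt_add_eq_append[of 0 p "length \<Psi> - p"] by simp
  then have "Ph @ Sg = map (\<lambda>i x. \<Sum>k<length \<Psi>. Q k i * (\<Psi> ! k) x) [0..<length \<Psi>]"
    unfolding PS map_append[symmetric] by simp
  then show ?thesis
    using orthonormal_on_rotate[OF assms(2)] Q unfolding qr_orthogonal_factor_def by simp
qed

text \<open>The scaling distributions enter the next coarser level, so orthonormality has to be carried
  from the leaves to the root for scaling distributions and samplets together.\<close>

lemma orthonormal_construction:
  assumes "finite X" "cluster_tree X t" "samplet_system X q t Ph Sg" "s \<in> nodes j t"
  shows "orthonormal_on X (sites s) (Ph s @ Sg s)"
proof -
  obtain bs where step: "\<And>j s. s \<in> nodes j t \<Longrightarrow> \<exists>\<Psi>.
        (if children s = []
         then \<exists>xs. distinct xs \<and> set xs = sites s \<and> \<Psi> = map dirac xs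
         else \<Psi> = concat (map Ph (children s))) \<and>
        samplet_step X bs \<Psi> (Ph s) (Sg s)"
    using assms(3) unfolding samplet_system_def by blast
  show ?thesis
    using assms(4)
  proof (induction s arbitrary: j)
    case (Cluster A cs)
    let ?s = "Cluster A cs"
    obtain \<Psi> where \<Psi>: "if cs = [] then \<exists>xs. distinct xs \<and> set xs = A \<and> \<Psi> = map dirac xs
         else \<Psi> = concat (map Ph cs)" and st: "samplet_step X bs \<Psi> (Ph ?s) (Sg ?s)"
      using step[OF Cluster.prems] unfolding ctree.sel by blast
    have "orthonormal_on X A \<Psi>"
    proof (cases "cs = []")
      case True
      then show ?thesis
        using \<Psi> orthonormal_on_dirac[OF assms(1)] cluster_subset[OF assms(2) Cluster.prems] by auto
    next
      case False
      have "orthonormal_on X (sites c) (Ph c)" if "c \<in> set cs" for c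
      proof -
        have "c \<in> nodes (j + 1) t"
          using nodes_trans[OF Cluster.prems, of c 1] that by simp
        from Cluster.IH[OF that this] show ?thesis
          by (auto simp: orthonormal_on_def sorted_wrt_append)
      qed
      moreover have "A = (\<Union>c\<in>set cs. sites c)"
        "disjoint_family_on (\<lambda>i. sites (cs ! i)) {..<length cs}"
        using assms(2) Cluster.prems False unfolding cluster_tree_def by fastforce+
      ultimately show ?thesis
        using False \<Psi> orthonormal_on_concat[of cs X sites Ph] by simp
    qed
    then show ?case
      using samplet_step_orthonormal[OF st] by simp
  qed
qed


section \<open>Pairing with a samplet\<close>

lemma abs_pairing_le_unit:
  assumes "finite X" "Y \<subseteq> X" and supp: "\<And>x. x \<notin> Y \<Longrightarrow> \<sigma> x = 0"
    and unit: "pairing X \<sigma> \<sigma> = 1" and g: "\<And>x. x \<in> Y \<Longrightarrow> \<bar>g x\<bar> \<le> b" and "0 \<le> b"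
  shows "\<bar>pairing X \<sigma> g\<bar> \<le> b * sqrt (real (card Y))"
proof -
  have restrict: "pairing X \<sigma> h = pairing Y \<sigma> h" for h
    unfolding pairing_def using assms(1,2) supp by (intro sum.mono_neutral_right) auto
  have "(\<Sum>x\<in>Y. \<bar>\<sigma> x\<bar> * \<bar>1\<bar>) \<le> L2_set \<sigma> Y * L2_set (\<lambda>_. 1) Y"
    by (rule L2_set_mult_ineq)
  also have "L2_set \<sigma> Y = 1"
    using unit[unfolded restrict] by (simp add: L2_set_def pairing_def power2_eq_square)
  finally have l1: "(\<Sum>x\<in>Y. \<bar>\<sigma> x\<bar>) \<le> sqrt (real (card Y))"
    by (simp add: L2_set_def)
  have "\<bar>pairing X \<sigma> g\<bar> \<le> (\<Sum>x\<in>Y. \<bar>\<sigma> x\<bar> * \<bar>g x\<bar>)"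
    unfolding restrict unfolding pairing_def abs_mult[symmetric] by (rule sum_abs)
  also have "\<dots> \<le> (\<Sum>x\<in>Y. \<bar>\<sigma> x\<bar> * b)"
    by (intro sum_mono mult_left_mono g) auto
  also have "\<dots> \<le> b * sqrt (real (card Y))"
    using mult_left_mono[OF l1 \<open>0 \<le> b\<close>] by (simp add: sum_distrib_left mult.commute)
  finally show ?thesis .
qed

text \<open>Vanishing moments allow subtracting \<open>p\<close> from \<open>f\<close>. As \<open>x0\<close> itself is a site of the cluster,
  all sites have distance at most the diameter from it.\<close>

lemma samplet_pairing_le:
  assumes "finite X" "cluster_tree X t" "samplet_system X q t Ph Sg" "vanishing_moments X q t Sg"
    and s: "s \<in> nodes j t" and \<sigma>: "\<sigma> \<in> set (Sg s)" and x0: "x0 \<in> sites s"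
    and p: "p \<in> polys q" and "0 \<le> C" "0 \<le> a"
    and approx: "\<And>x. x \<in> sites s \<Longrightarrow> \<bar>f x - p x\<bar> \<le> C * norm (x - x0) powr a"
  shows "\<bar>pairing X \<sigma> f\<bar> \<le> C * (diameter (sites s) powr a * sqrt (real (card (sites s))))"
proof -
  have sub: "sites s \<subseteq> X"
    using assms(2) s by (rule cluster_subset)
  have "bounded (sites s)"
    using finite_subset[OF sub assms(1)] by (rule finite_imp_bounded)
  have near: "\<bar>f x - p x\<bar> \<le> C * diameter (sites s) powr a" if x: "x \<in> sites s" for x
  proof -
    have "norm (x - x0) \<le> diameter (sites s)"
      using diameter_bounded_bound[OF \<open>bounded (sites s)\<close> x x0] by (simp add: dist_norm)
    then have "C * norm (x - x0) powr a \<le> C * diameter (sites s) powr a"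
      using \<open>0 \<le> a\<close> \<open>0 \<le> C\<close> by (intro mult_left_mono powr_mono2) auto
    then show ?thesis using approx[OF x] by linarith
  qed
  have "pairing X \<sigma> p = 0"
    using assms(4) s \<sigma> p unfolding vanishing_moments_def by blast
  then have "pairing X \<sigma> f = pairing X \<sigma> (\<lambda>x. f x - p x)"
    by (simp add: pairing_def right_diff_distrib sum_subtractf)
  moreover have "orthonormal_on X (sites s) (Ph s @ Sg s)"
    using assms(1-3) s by (rule orthonormal_construction)
  then have "\<And>x. x \<notin> sites s \<Longrightarrow> \<sigma> x = 0" "pairing X \<sigma> \<sigma> = 1"
    using \<sigma> by (auto simp: orthonormal_on_def)
  ultimately show ?thesis
    using abs_pairing_le_unit[OF assms(1) sub _ _ near] \<open>0 \<le> C\<close> by (simp add: mult.assoc)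
qed


section \<open>Geometric clustering\<close>

lemma geometric_cell:
  assumes "geometric a b t" "s \<in> nodes j t"
  shows "\<exists>a' b'. sites s \<subseteq> cbox a' b' \<and> (\<forall>k. b' $ k - a' $ k = (b $ k - a $ k) / 2 ^ j)"
  using assms
proof (induction j arbitrary: t a b)
  case 0
  have "sites t \<subseteq> cbox a b"
    using "0.prems"(1) by cases auto
  then show ?case
    using "0.prems"(2) by auto
next
  case (Suc j)
  obtain c where c: "c \<in> set (children t)" "s \<in> nodes j c"
    using Suc.prems(2) by auto
  from Suc.prems(1) show ?case
  proof cases
    case (leaf A)
    then show ?thesis using c by simp
  next
    case (split A u ts)
    then obtain i where "i < length ts" "c = ts ! i"
      using c(1) by (auto simp: in_set_conv_nth)
    with split have "geometric (\<chi> k. if k \<in> u i then (a $ k + b $ k) / 2 else a $ k)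
        (\<chi> k. if k \<in> u i then b $ k else (a $ k + b $ k) / 2) c"
      by blast
    from Suc.IH[OF this c(2)] obtain a' b' where "sites s \<subseteq> cbox a' b'"
      and *: "\<And>k. b' $ k - a' $ k = ((if k \<in> u i then b $ k else (a $ k + b $ k) / 2)
         - (if k \<in> u i then (a $ k + b $ k) / 2 else a $ k)) / 2 ^ j"
      by auto
    moreover have "b' $ k - a' $ k = (b $ k - a $ k) / 2 ^ Suc j" for k
      unfolding * by (auto simp: field_simps)
    ultimately show ?thesis by blast
  qed
qed

lemma geometric_diameter:
  fixes t :: "(real ^ 'n::finite) ctree"
  assumes "geometric 0 1 t" "s \<in> nodes j t"
  shows "diameter (sites s) \<le> sqrt (real CARD('n)) * 2 powr - real j"
proof (rule diameter_le)
  obtain a b where ab: "sites s \<subseteq> cbox a b" "\<And>k. b $ k - a $ k = 1 / 2 ^ j"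
    using geometric_cell[OF assms] by auto
  fix x y assume "x \<in> sites s" "y \<in> sites s"
  with ab(1) have "x \<in> cbox a b" "y \<in> cbox a b"
    by auto
  then have "\<bar>(x - y) $ k\<bar> \<le> 1 / 2 ^ j" for k
    using ab(2)[of k] by (auto simp: mem_box_cart abs_le_iff dest!: spec[of _ k])
  then have "L2_set (\<lambda>k. norm ((x - y) $ k)) UNIV \<le> L2_set (\<lambda>_::'n. 1 / 2 ^ j) UNIV"
    by (intro L2_set_mono) auto
  also have "\<dots> = sqrt (real CARD('n)) * 2 powr - real j"
    by (simp add: L2_set_def real_sqrt_mult powr_minus powr_realpow divide_inverse power_inverse real_sqrt_inverse)
  finally show "norm (x - y) \<le> sqrt (real CARD('n)) * 2 powr - real j"
    by (simp add: norm_vec_def)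
qed simp

theorem corollary3p3:
  fixes f :: "real ^ 'n \<Rightarrow> real" and \<Omega> :: "(real ^ 'n) set" and x0 :: "real ^ 'n"
    and R \<theta> \<gamma> c M :: real and m :: nat
  assumes "0 < \<theta>" "\<theta> \<le> 1" "0 < R" "x0 \<in> \<Omega>"
    and "f \<in> holder_space m \<theta> (cball x0 R)"
  shows
    "(\<exists>C. \<forall>X q t Ph Sg j s \<sigma>.
        finite X \<and> X \<noteq> {} \<and> X \<subseteq> \<Omega> \<and> quasi_uniform \<gamma> \<Omega> X \<and> cluster_tree X t \<and>
        samplet_system X q t Ph Sg \<and> m \<le> q \<and> vanishing_moments X q t Sg \<and>
        s \<in> nodes j t \<and> x0 \<in> sites s \<and> \<sigma> \<in> set (Sg s) \<and>
        (\<forall>x\<in>sites s - cball x0 R. \<bar>f x\<bar> \<le> M)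
        \<longrightarrow> \<bar>pairing X \<sigma> f\<bar>
              \<le> C * (diameter (sites s) powr (\<theta> + real m) * sqrt (real (card (sites s)))))
     \<and>
     (\<Omega> = cbox 0 1 \<longrightarrow>
      (\<exists>C. \<forall>X q t Ph Sg j s \<sigma>.
        finite X \<and> X \<noteq> {} \<and> X \<subseteq> \<Omega> \<and> quasi_uniform \<gamma> \<Omega> X \<and> cluster_tree X t \<and>
        two_pow_d_tree t \<and> geometric 0 1 t \<and> balanced c t \<and>
        samplet_system X q t Ph Sg \<and> m \<le> q \<and> vanishing_moments X q t Sg \<and>
        s \<in> nodes j t \<and> x0 \<in> sites s \<and> \<sigma> \<in> set (Sg s) \<and>
        (\<forall>x\<in>sites s - cball x0 R. \<bar>f x\<bar> \<le> M)
        \<longrightarrow> \<bar>pairing X \<sigma> f\<bar>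
              \<le> C * (sqrt (real (card X) * real CARD('n) powr (\<theta> + real m))
                     * 2 powr - (real j * (\<theta> + real m + real CARD('n) / 2)))))"
proof -
  define a where "a = \<theta> + real m"
  obtain p C where p: "p \<in> polys m" and C: "0 \<le> C"
    and approx: "\<And>x. x \<in> cball x0 R \<or> \<bar>f x\<bar> \<le> M \<Longrightarrow> \<bar>f x - p x\<bar> \<le> C * norm (x - x0) powr a"
    using taylor_approximation[OF assms(5,1,3), of M] unfolding a_def by blast
  have a: "0 \<le> a" using assms(1) by (simp add: a_def)
  have main: "\<bar>pairing X \<sigma> f\<bar> \<le> C * (diameter (sites s) powr a * sqrt (real (card (sites s))))"
    if "finite X" "cluster_tree X t" "samplet_system X q t Ph Sg" "m \<le> q"
      "vanishing_moments X q t Sg" "s \<in> nodes j t" "x0 \<in> sites s" "\<sigma> \<in> set (Sg s)"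
      "\<forall>x\<in>sites s - cball x0 R. \<bar>f x\<bar> \<le> M" for X q t Ph Sg j s \<sigma>
    by (rule samplet_pairing_le[where p = p, OF that(1-3,5,6,8,7) polys_mono[OF p that(4)] C a])
      (use approx that(9) in blast)
  have tree: "\<bar>pairing X \<sigma> f\<bar> \<le> C * sqrt \<bar>c\<bar> * (sqrt (real (card X) * real CARD('n) powr a)
                     * 2 powr - (real j * (a + real CARD('n) / 2)))"
    if "finite X" "cluster_tree X t" "geometric 0 1 t" "balanced c t"
      "samplet_system X q t Ph Sg" "m \<le> q" "vanishing_moments X q t Sg"
      "s \<in> nodes j t" "x0 \<in> sites s" "\<sigma> \<in> set (Sg s)"
      "\<forall>x\<in>sites s - cball x0 R. \<bar>f x\<bar> \<le> M"
    for X t q Ph Sg j s \<sigma>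
  proof -
    define d N where "d = real CARD('n)" and "N = real (card X)"
    have "diameter (sites s) powr a \<le> (sqrt d * 2 powr - real j) powr a"
      using geometric_diameter[OF that(3,8)] a
        diameter_ge_0[OF finite_imp_bounded[OF finite_subset[OF cluster_subset[OF that(2,8)] that(1)]]]
      unfolding d_def by (intro powr_mono2) auto
    also have "\<dots> = sqrt (d powr a) * 2 powr - (real j * a)"
      by (simp add: powr_mult powr_powr powr_half_sqrt[symmetric] d_def mult_ac)
    finally have diam: "diameter (sites s) powr a \<le> sqrt (d powr a) * 2 powr - (real j * a)" .
    have "sites t = X"
      using that(2) by (simp add: cluster_tree_def)
    then have "real (card (sites s)) \<le> c * (N * 2 powr - (real j * d))"
      using that(4,8) unfolding balanced_def d_def N_def by blast
    also have "\<dots> \<le> \<bar>c\<bar> * (N * 2 powr - (real j * d))"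
      by (intro mult_right_mono) (auto simp: N_def)
    finally have "sqrt (real (card (sites s))) \<le> sqrt (\<bar>c\<bar> * (N * 2 powr - (real j * d)))"
      by simp
    also have "\<dots> = sqrt \<bar>c\<bar> * (sqrt N * 2 powr - (real j * d / 2))"
      by (simp add: real_sqrt_mult powr_half_sqrt[symmetric] powr_powr)
    finally have card: "sqrt (real (card (sites s))) \<le> sqrt \<bar>c\<bar> * (sqrt N * 2 powr - (real j * d / 2))" .
    have "\<bar>pairing X \<sigma> f\<bar> \<le> C * (diameter (sites s) powr a * sqrt (real (card (sites s))))"
      using that by (intro main)
    also have "\<dots> \<le> C * ((sqrt (d powr a) * 2 powr - (real j * a)) *
        (sqrt \<bar>c\<bar> * (sqrt N * 2 powr - (real j * d / 2))))"
      using diam card C by (intro mult_left_mono mult_mono) auto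
    also have "\<dots> = C * sqrt \<bar>c\<bar> * (sqrt (N * d powr a) * 2 powr - (real j * (a + d / 2)))"
      by (simp add: real_sqrt_mult powr_add[symmetric] algebra_simps)
    finally show ?thesis by (simp add: d_def N_def)
  qed
  show ?thesis
    unfolding a_def[symmetric]
  proof (intro conjI impI, goal_cases)
    case 1
    show ?case
      by (rule exI[of _ C], intro allI impI, elim conjE, rule main)
  next
    case 2
    show ?case
      by (rule exI[of _ "C * sqrt \<bar>c\<bar>"], intro allI impI, elim conjE, rule tree)
  qed
qed

end
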